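(* Let $(X,G,\Phi)$ be a minimal equicontinuous action of a finitely generated infinite group $G$ on a Cantor set $X$. Suppose the discriminant group $\mathcal{D}_x$ is finite for some $x\in X$. Then $(X,G,\Phi)$ is virtually regular.
   Context: $\Phi\colon G\times X\to X$ is an action by homeomorphisms; write $g\cdot x=\Phi(g)(x)$. The action is minimal if every orbit is dense, and equicontinuous (with respect to a metric $d$ on $X$) if for all $\varepsilon>0$ there is $\delta>0$ such that $d(u,v)<\delta$ implies $d(g\cdot u,g\cdot v)<\varepsilon$ for all $u,v\in X$, $g\in G$. A group chain in a group $G$ is a properly descending chain $G=G_0\supset G_1\supset\cdots$ of subgroups of finite index. A group chain associated to $(X,G,\Phi)$ with basepoint $x$ is obtained from clopen sets $X=V_0\supset V_1\supset\cdots$ with $\bigcap_iV_i=\{x\}$ such that each $\mathcal{P}_i=\{g\cdot V_i\}_{g\in G}$ is a finite partition of $X$ and $\mathrm{diam}(g\cdot V_i)<2^{-i}$ for all $g\in G$, $i\ge1$, by setting $G_i=\{g\in G\mid g\cdot V_i=V_i\}$. With $C_i=\bigcap_{g\in G}gG_ig^{-1}$, the discriminant group at $x$ is $\mathcal{D}_x=\varprojlim\{G_{i+1}/C_{i+1}\to G_i/C_i\}$ (bonding maps induced by inclusion of cosets); up to isomorphism it does not depend on the choices. Two group chains $\{G_i\}$, $\{H_i\}$ in the same group $G$ are equivalent if there are infinite subsequences with $G_{i_0}\supset H_{j_0}\supset G_{i_1}\supset H_{j_1}\supset\cdots$ forming a group chain in $G$. They are conjugate equivalent if there is a sequence $(g_i)$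 in $G$ with $g_iG_i=g_jG_i$ for all $i\ge0$ and all $j\ge i$ such that $\{g_iG_ig_i^{-1}\}$ and $\{H_i\}$ are equivalent. A group chain $\{G_i\}_{i\ge0}$ is weakly normal if there is $i_0\ge0$ such that, for the truncated chain $\{G_i\}_{i\ge i_0}$ viewed as a group chain in the group $G_{i_0}$, every group chain in $G_{i_0}$ which is conjugate equivalent to it (in $G_{i_0}$) is equivalent to it. The action $(X,G,\Phi)$, with associated group chain $\{G_i\}_{i\ge0}$, is virtually regular if there is a subgroup $G_0'\subset G$ of finite index such that the restricted chain $\{G_i'=G_i\cap G_0'\}_{i\ge0}$ (discarding repeated terms if necessary) is weakly normal as a group chain in $G_0'$. *)

theory Defs
  imports
    "HOL-Analysis.Analysis"
    "HOL-Algebra.Group_Action"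
    "HOL-Algebra.Product_Groups"
    "HOL-Library.Infinite_Set"
    "HOL-Library.Disjoint_Sets"
begin

section \<open>Minimal equicontinuous actions on Cantor sets\<close>

definition finitely_generated_group :: "('g, 'b) monoid_scheme \<Rightarrow> bool" where
  "finitely_generated_group G \<longleftrightarrow>
     group G \<and> (\<exists>S. finite S \<and> S \<subseteq> carrier G \<and> generate G S = carrier G)"

definition Cantor_set :: "'x::metric_space set \<Rightarrow> bool" where
  "Cantor_set X \<longleftrightarrow> X homeomorphic (UNIV :: (nat \<Rightarrow> bool) set)"

definition action_by_homeomorphisms ::
    "('g, 'b) monoid_scheme \<Rightarrow> 'x::metric_space set \<Rightarrow> ('g \<Rightarrow> 'x \<Rightarrow> 'x) \<Rightarrow> bool" where
  "action_by_homeomorphisms G X \<Phi> \<longleftrightarrow>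
     group_action G X \<Phi> \<and>
     (\<forall>g\<in>carrier G. homeomorphism X X (\<Phi> g) (\<Phi> (inv\<^bsub>G\<^esub> g)))"

definition minimal_action ::
    "('g, 'b) monoid_scheme \<Rightarrow> 'x::metric_space set \<Rightarrow> ('g \<Rightarrow> 'x \<Rightarrow> 'x) \<Rightarrow> bool" where
  "minimal_action G X \<Phi> \<longleftrightarrow> (\<forall>x\<in>X. X \<subseteq> closure (orbit G \<Phi> x))"

definition equicontinuous_action ::
    "('g, 'b) monoid_scheme \<Rightarrow> 'x::metric_space set \<Rightarrow> ('g \<Rightarrow> 'x \<Rightarrow> 'x) \<Rightarrow> bool" where
  "equicontinuous_action G X \<Phi> \<longleftrightarrow>
     (\<forall>\<epsilon>>0. \<exists>\<delta>>0. \<forall>u\<in>X. \<forall>v\<in>X. \<forall>g\<in>carrier G.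
        dist u v < \<delta> \<longrightarrow> dist (\<Phi> g u) (\<Phi> g v) < \<epsilon>)"


section \<open>Group chains\<close>

definition finite_index_subgroup :: "'g set \<Rightarrow> ('g, 'b) monoid_scheme \<Rightarrow> bool" where
  "finite_index_subgroup H G \<longleftrightarrow> subgroup H G \<and> finite (rcosets\<^bsub>G\<^esub> H)"

definition group_chain :: "('g, 'b) monoid_scheme \<Rightarrow> (nat \<Rightarrow> 'g set) \<Rightarrow> bool" where
  "group_chain G K \<longleftrightarrow>
     K 0 = carrier G \<and> (\<forall>i. finite_index_subgroup (K i) G \<and> K (Suc i) \<subset> K i)"

definition associated_group_chain ::
    "('g, 'b) monoid_scheme \<Rightarrow> 'x::metric_space set \<Rightarrow> ('g \<Rightarrow> 'x \<Rightarrow> 'x) \<Rightarrow> 'x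
       \<Rightarrow> (nat \<Rightarrow> 'g set) \<Rightarrow> bool" where
  "associated_group_chain G X \<Phi> x K \<longleftrightarrow>
     group_chain G K \<and>
     (\<exists>V :: nat \<Rightarrow> 'x set.
        V 0 = X \<and> (\<forall>i. V (Suc i) \<subseteq> V i) \<and> (\<Inter>i. V i) = {x} \<and>
        (\<forall>i. openin (top_of_set X) (V i) \<and> closedin (top_of_set X) (V i)) \<and>
        (\<forall>i. finite {\<Phi> g ` V i | g. g \<in> carrier G} \<and>
             partition_on X {\<Phi> g ` V i | g. g \<in> carrier G}) \<and>
        (\<forall>i\<ge>1. \<forall>g\<in>carrier G. diameter (\<Phi> g ` V i) < 1 / 2 ^ i) \<and>
        (\<forall>i. K i = {g \<in> carrier G. \<Phi> g ` V i = V i}))"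

definition conjugate_subset :: "('g, 'b) monoid_scheme \<Rightarrow> 'g \<Rightarrow> 'g set \<Rightarrow> 'g set" where
  "conjugate_subset G g H = (g <#\<^bsub>G\<^esub> H) #>\<^bsub>G\<^esub> (inv\<^bsub>G\<^esub> g)"

definition normal_core :: "('g, 'b) monoid_scheme \<Rightarrow> 'g set \<Rightarrow> 'g set" where
  "normal_core G H = (\<Inter>g\<in>carrier G. conjugate_subset G g H)"


section \<open>The discriminant group\<close>

text \<open>The inverse limit of a sequence of groups \<open>A 0, A 1, \<dots>\<close> with bonding maps
  \<open>\<beta> i\<close> from \<open>A (Suc i)\<close> to \<open>A i\<close>.\<close>

definition inverse_limit ::
    "(nat \<Rightarrow> ('a, 'b) monoid_scheme) \<Rightarrow> (nat \<Rightarrow> 'a \<Rightarrow> 'a) \<Rightarrow> (nat \<Rightarrow> 'a) monoid" where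
  "inverse_limit A \<beta> =
     (product_group UNIV A)
       \<lparr>carrier := {s \<in> carrier (product_group UNIV A). \<forall>i. \<beta> i (s (Suc i)) = s i}\<rparr>"

text \<open>Multiplying a coset \<open>C\<^sub>i\<^sub>+\<^sub>1 g\<close> by \<open>C\<^sub>i\<close> gives the coset \<open>C\<^sub>i g\<close> containing it, so the
  bonding map below is the one induced by inclusion of cosets.\<close>

definition discriminant_group ::
    "('g, 'b) monoid_scheme \<Rightarrow> (nat \<Rightarrow> 'g set) \<Rightarrow> (nat \<Rightarrow> 'g set) monoid" where
  "discriminant_group G K =
     inverse_limit (\<lambda>i. (G\<lparr>carrier := K i\<rparr>) Mod (normal_core G (K i)))
                   (\<lambda>i A. normal_core G (K i) <#>\<^bsub>G\<^esub> A)"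


section \<open>Equivalence of group chains and virtual regularity\<close>

definition equivalent_chains ::
    "('g, 'b) monoid_scheme \<Rightarrow> (nat \<Rightarrow> 'g set) \<Rightarrow> (nat \<Rightarrow> 'g set) \<Rightarrow> bool" where
  "equivalent_chains G K H \<longleftrightarrow>
     (\<exists>i j :: nat \<Rightarrow> nat. strict_mono i \<and> strict_mono j \<and>
        group_chain G (\<lambda>n. if even n then K (i (n div 2)) else H (j (n div 2))))"

definition conjugate_equivalent_chains ::
    "('g, 'b) monoid_scheme \<Rightarrow> (nat \<Rightarrow> 'g set) \<Rightarrow> (nat \<Rightarrow> 'g set) \<Rightarrow> bool" where
  "conjugate_equivalent_chains G K H \<longleftrightarrow>
     (\<exists>g :: nat \<Rightarrow> 'g. (\<forall>i. g i \<in> carrier G) \<and>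
        (\<forall>i. \<forall>j\<ge>i. g i <#\<^bsub>G\<^esub> K i = g j <#\<^bsub>G\<^esub> K i) \<and>
        equivalent_chains G (\<lambda>i. conjugate_subset G (g i) (K i)) H)"

definition weakly_normal :: "('g, 'b) monoid_scheme \<Rightarrow> (nat \<Rightarrow> 'g set) \<Rightarrow> bool" where
  "weakly_normal G K \<longleftrightarrow>
     group_chain G K \<and>
     (\<exists>i\<^sub>0. \<forall>H. group_chain (G\<lparr>carrier := K i\<^sub>0\<rparr>) H \<and>
        conjugate_equivalent_chains (G\<lparr>carrier := K i\<^sub>0\<rparr>) (\<lambda>i. K (i\<^sub>0 + i)) H \<longrightarrow>
        equivalent_chains (G\<lparr>carrier := K i\<^sub>0\<rparr>) (\<lambda>i. K (i\<^sub>0 + i)) H)"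

text \<open>Keeps, in order, the terms that differ from all earlier ones; meaningful only for sequences
  with infinitely many distinct terms.\<close>

definition discard_repeats :: "(nat \<Rightarrow> 'a) \<Rightarrow> nat \<Rightarrow> 'a" where
  "discard_repeats K n = K (enumerate {i. \<forall>j<i. K j \<noteq> K i} n)"

text \<open>Virtual regularity does not depend on the basepoint or on the associated group chain; the
  property is required here of all of them.\<close>

definition virtually_regular ::
    "('g, 'b) monoid_scheme \<Rightarrow> 'x::metric_space set \<Rightarrow> ('g \<Rightarrow> 'x \<Rightarrow> 'x) \<Rightarrow> bool" where
  "virtually_regular G X \<Phi> \<longleftrightarrow>
     (\<forall>x\<in>X. \<forall>K. associated_group_chain G X \<Phi> x K \<longrightarrow>
        (\<exists>G'. finite_index_subgroup G' G \<and>
              weakly_normal (G\<lparr>carrier := G'\<rparr>) (discard_repeats (\<lambda>i. K i \<inter> G'))))"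

end

theory Submission
  imports Defs
begin

text \<open>
  Let \<open>C\<^sub>i\<close> be the normal core of \<open>K\<^sub>i\<close>. If the discriminant group is finite, its nontrivial elements
  are already nontrivial modulo a fixed \<open>C\<^sub>i\<close>, and a compactness argument gives for every \<open>j\<close> some
  \<open>m\<close> with \<open>K\<^sub>m \<inter> C\<^sub>i \<subseteq> C\<^sub>j\<close>. Hence in the finite index subgroup \<open>C\<^sub>i\<close> the chain \<open>K\<^sub>m \<inter> C\<^sub>i\<close> is
  cofinal with the chain of normal subgroups \<open>C\<^sub>m\<close>, so conjugating its members does not leave its
  equivalence class. The condition does not depend on the basepoint or on the clopen sets: a small
  set of one family lies in a translate of any given set of another, so the two group chains are
  mutually cofinal up to conjugation.
\<close>

section \<open>Normal cores and finite index\<close>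

context group
begin

lemma inv_mult_cancel:
  assumes "g \<in> carrier G" "x \<in> carrier G"
  shows "inv g \<otimes> (g \<otimes> x) = x" "g \<otimes> (inv g \<otimes> x) = x"
  using assms by (simp_all add: m_assoc[symmetric])

lemma mem_conjugate_subset_iff:
  assumes "g \<in> carrier G" "H \<subseteq> carrier G"
  shows "x \<in> conjugate_subset G g H \<longleftrightarrow> x \<in> carrier G \<and> inv g \<otimes> x \<otimes> g \<in> H"
proof
  assume "x \<in> conjugate_subset G g H"
  then obtain h where h: "h \<in> H" "x = g \<otimes> h \<otimes> inv g"
    by (auto simp: conjugate_subset_def l_coset_def r_coset_def)
  then have "h \<in> carrier G"
    using assms by auto
  then show "x \<in> carrier G \<and> inv g \<otimes> x \<otimes> g \<in> H"
    using h assms by (simp add: m_assoc inv_mult_cancel)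
next
  assume x: "x \<in> carrier G \<and> inv g \<otimes> x \<otimes> g \<in> H"
  then have "x = g \<otimes> (inv g \<otimes> x \<otimes> g) \<otimes> inv g"
    using assms by (simp add: m_assoc inv_mult_cancel)
  then show "x \<in> conjugate_subset G g H"
    using x unfolding conjugate_subset_def l_coset_def r_coset_def by blast
qed

lemma mem_normal_core_iff:
  assumes "H \<subseteq> carrier G"
  shows "x \<in> normal_core G H \<longleftrightarrow> x \<in> carrier G \<and> (\<forall>g\<in>carrier G. inv g \<otimes> x \<otimes> g \<in> H)"
  unfolding normal_core_def using assms by (auto simp: mem_conjugate_subset_iff)

lemma normal_core_subset:
  assumes "H \<subseteq> carrier G"
  shows "normal_core G H \<subseteq> H"
proof
  fix x assume "x \<in> normal_core G H"
  then have "x \<in> carrier G" "inv \<one> \<otimes> x \<otimes> \<one> \<in> H"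
    using assms by (auto simp: mem_normal_core_iff)
  then show "x \<in> H"
    by simp
qed

lemma normal_core_mono:
  "H \<subseteq> H' \<Longrightarrow> normal_core G H \<subseteq> normal_core G H'"
  unfolding normal_core_def conjugate_subset_def l_coset_def r_coset_def by blast

lemma conj_mem_normal_core:
  assumes "H \<subseteq> carrier G" "x \<in> normal_core G H" "g \<in> carrier G"
  shows "inv g \<otimes> x \<otimes> g \<in> normal_core G H"
proof -
  have x: "x \<in> carrier G" "\<And>h. h \<in> carrier G \<Longrightarrow> inv h \<otimes> x \<otimes> h \<in> H"
    using assms by (auto simp: mem_normal_core_iff)
  have "inv h \<otimes> (inv g \<otimes> x \<otimes> g) \<otimes> h \<in> H" if "h \<in> carrier G" for h
    using x(2)[of "g \<otimes> h"] x(1) that assms(3) by (simp add: inv_mult_group m_assoc)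
  then show ?thesis
    using assms x(1) by (simp add: mem_normal_core_iff)
qed

lemma subgroup_normal_core:
  assumes "subgroup H G"
  shows "subgroup (normal_core G H) G"
proof -
  have H: "H \<subseteq> carrier G"
    using assms by (rule subgroup.subset)
  show ?thesis
  proof (rule subgroupI)
    show "normal_core G H \<subseteq> carrier G"
      using H by (auto simp: mem_normal_core_iff)
    have "\<one> \<in> normal_core G H"
      using H assms by (simp add: mem_normal_core_iff subgroup.one_closed)
    then show "normal_core G H \<noteq> {}"
      by blast
    show "inv a \<in> normal_core G H" if "a \<in> normal_core G H" for a
    proof -
      have a: "a \<in> carrier G" "\<And>g. g \<in> carrier G \<Longrightarrow> inv g \<otimes> a \<otimes> g \<in> H"
        using that H by (auto simp: mem_normal_core_iff)
      have "inv g \<otimes> inv a \<otimes> g \<in> H" if "g \<in> carrier G" for g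
        using subgroup.m_inv_closed[OF assms a(2)[OF that]] a(1) that
        by (simp add: inv_mult_group m_assoc)
      then show ?thesis
        using H a(1) by (simp add: mem_normal_core_iff)
    qed
    show "a \<otimes> b \<in> normal_core G H" if "a \<in> normal_core G H" "b \<in> normal_core G H" for a b
    proof -
      have ab: "a \<in> carrier G" "b \<in> carrier G" "\<And>g. g \<in> carrier G \<Longrightarrow> inv g \<otimes> a \<otimes> g \<in> H"
          "\<And>g. g \<in> carrier G \<Longrightarrow> inv g \<otimes> b \<otimes> g \<in> H"
        using that H by (auto simp: mem_normal_core_iff)
      have "inv g \<otimes> (a \<otimes> b) \<otimes> g \<in> H" if "g \<in> carrier G" for g
      proof -
        have "inv g \<otimes> (a \<otimes> b) \<otimes> g = (inv g \<otimes> a \<otimes> g) \<otimes> (inv g \<otimes> b \<otimes> g)"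
          using that ab(1,2) by (simp add: m_assoc inv_mult_cancel)
        then show ?thesis
          using subgroup.m_closed[OF assms ab(3,4)] that by simp
      qed
      then show ?thesis
        using H ab(1,2) by (simp add: mem_normal_core_iff)
    qed
  qed
qed

section \<open>Cosets and subgroups of finite index\<close>

lemma mem_if_rcos_eq:
  assumes "subgroup H G" "H #> a = H #> b" "a \<in> carrier G" "b \<in> carrier G"
  shows "a \<otimes> inv b \<in> H"
  by (rule coset_join1[OF coset_mult_inv2]) (use assms subgroup.subset in auto)

text \<open>Since \<open>\<phi> a = \<phi> b\<close> forces \<open>H #> a = H #> b\<close>, there
  are at most as many right cosets as values of \<open>\<phi>\<close>. An arbitrary function is
  allowed, so that pairs of cosets or graphs of permutations can serve as
  \<open>\<phi>\<close>.\<close>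

lemma finite_index_subgroupI:
  assumes H: "subgroup H G" and fin: "finite (\<phi> ` carrier G)"
    and inj: "\<And>a b. a \<in> carrier G \<Longrightarrow> b \<in> carrier G \<Longrightarrow> \<phi> a = \<phi> b \<Longrightarrow> a \<otimes> inv b \<in> H"
  shows "finite_index_subgroup H G"
proof -
  have coset: "H #> a = H #> b" if "a \<in> carrier G" "b \<in> carrier G" "\<phi> a = \<phi> b" for a b
  proof -
    have "a = (a \<otimes> inv b) \<otimes> b"
      using that by (simp add: m_assoc)
    then have "a \<in> H #> b"
      using inj[OF that] unfolding r_coset_def by blast
    then show ?thesis
      using repr_independence[OF _ that(2) H] by simp
  qed
  have "rcosets H \<subseteq> (\<lambda>v. H #> (SOME a. a \<in> carrier G \<and> \<phi> a = v)) ` \<phi> ` carrier G"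
  proof
    fix R assume "R \<in> rcosets H"
    then obtain a where a: "a \<in> carrier G" "R = H #> a"
      by (auto simp: RCOSETS_def)
    let ?b = "SOME b. b \<in> carrier G \<and> \<phi> b = \<phi> a"
    have "?b \<in> carrier G \<and> \<phi> ?b = \<phi> a"
      by (rule someI[of _ a]) (simp add: a)
    then have "R = H #> ?b"
      using coset a by metis
    then show "R \<in> (\<lambda>v. H #> (SOME a. a \<in> carrier G \<and> \<phi> a = v)) ` \<phi> ` carrier G"
      using a(1) by blast
  qed
  then show ?thesis
    unfolding finite_index_subgroup_def using H fin by (meson finite_imageI finite_subset)
qed

lemma finite_index_subgroup_Int:
  assumes H: "finite_index_subgroup H G" and K: "finite_index_subgroup K G"
  shows "finite_index_subgroup (H \<inter> K) G"
proof (rule finite_index_subgroupI[where \<phi> = "\<lambda>a. (H #> a, K #> a)"])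
  have sub: "subgroup H G" "subgroup K G"
    using assms by (auto simp: finite_index_subgroup_def)
  then show "subgroup (H \<inter> K) G"
    by (rule subgroups_Inter_pair)
  have "(\<lambda>a. (H #> a, K #> a)) ` carrier G \<subseteq> (rcosets H) \<times> (rcosets K)"
    by (auto simp: RCOSETS_def)
  then show "finite ((\<lambda>a. (H #> a, K #> a)) ` carrier G)"
    using assms by (meson finite_SigmaI finite_index_subgroup_def finite_subset)
  fix a b assume "a \<in> carrier G" "b \<in> carrier G" "(H #> a, K #> a) = (H #> b, K #> b)"
  then show "a \<otimes> inv b \<in> H \<inter> K"
    using mem_if_rcos_eq[OF sub(1)] mem_if_rcos_eq[OF sub(2)] by simp
qed

text \<open>\<open>G\<close> permutes the finitely many right cosets of \<open>H\<close> by right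
  multiplication, and the core is the kernel of this action.\<close>

lemma finite_index_subgroup_normal_core:
  assumes H: "finite_index_subgroup H G"
  shows "finite_index_subgroup (normal_core G H) G"
proof -
  have sub: "subgroup H G" and fin: "finite (rcosets H)"
    using H by (auto simp: finite_index_subgroup_def)
  have HG: "H \<subseteq> carrier G"
    using sub by (rule subgroup.subset)
  \<comment> \<open>the permutation of the right cosets of \<open>H\<close> induced by right multiplication, as a graph\<close>
  define \<phi> where "\<phi> a = {(H #> g, H #> (g \<otimes> a)) | g. g \<in> carrier G}" for a
  show ?thesis
  proof (rule finite_index_subgroupI[where \<phi> = \<phi>])
    show "subgroup (normal_core G H) G"
      using sub by (rule subgroup_normal_core)
    have "\<phi> ` carrier G \<subseteq> Pow ((rcosets H) \<times> (rcosets H))"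
      by (auto simp: RCOSETS_def \<phi>_def)
    then show "finite (\<phi> ` carrier G)"
      using fin by (meson finite_Pow_iff finite_SigmaI finite_subset)
    fix a b assume ab: "a \<in> carrier G" "b \<in> carrier G" "\<phi> a = \<phi> b"
    have "inv g \<otimes> (a \<otimes> inv b) \<otimes> g \<in> H" if g: "g \<in> carrier G" for g
    proof -
      have "(H #> inv g, H #> (inv g \<otimes> a)) \<in> \<phi> b"
        using g unfolding ab(3)[symmetric] by (auto simp: \<phi>_def)
      then obtain k where k: "k \<in> carrier G" "H #> inv g = H #> k" "H #> (inv g \<otimes> a) = H #> (k \<otimes> b)"
        by (auto simp: \<phi>_def)
      \<comment> \<open>The graph of \<open>b\<close> may list the pair through another
        representative \<open>k\<close> of the coset of \<open>inv g\<close>; right multiplication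
        is well defined on cosets, so \<open>k\<close> can be replaced by
        \<open>inv g\<close>.\<close>
      have "H #> (k \<otimes> b) = H #> (inv g \<otimes> b)"
        using k(1,2) HG g ab by (metis coset_mult_assoc inv_closed)
      then have "(inv g \<otimes> a) \<otimes> inv (inv g \<otimes> b) \<in> H"
        using k(3) g ab by (intro mem_if_rcos_eq[OF sub]) auto
      then show ?thesis
        using g ab by (simp add: inv_mult_group m_assoc)
    qed
    then show "a \<otimes> inv b \<in> normal_core G H"
      using HG ab by (simp add: mem_normal_core_iff)
  qed
qed

lemma finite_index_subgroup_restrict:
  assumes "finite_index_subgroup H G" "subgroup M G" "H \<subseteq> M"
  shows "finite_index_subgroup H (G\<lparr>carrier := M\<rparr>)"
proof -
  have "rcosets\<^bsub>G\<lparr>carrier := M\<rparr>\<^esub> H \<subseteq> rcosets H"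
    using subgroup.subset[OF assms(2)] by (auto simp: RCOSETS_def r_coset_def)
  then show ?thesis
    using assms subgroup_incl unfolding finite_index_subgroup_def
    by (blast intro: finite_subset)
qed

text \<open>An overgroup of \<open>L\<close> is a union of right cosets of \<open>L\<close>, of
  which there are finitely many. This will prevent infinitely many distinct subgroups from lying
  above one subgroup of finite index.\<close>

lemma finite_overgroups:
  assumes L: "finite_index_subgroup L G"
  shows "finite {H. subgroup H G \<and> L \<subseteq> H}"
proof -
  have sub: "subgroup L G"
    using L by (simp add: finite_index_subgroup_def)
  have "{H. subgroup H G \<and> L \<subseteq> H} \<subseteq> Union ` Pow (rcosets L)"
  proof
    fix H assume "H \<in> {H. subgroup H G \<and> L \<subseteq> H}"
    then have H: "subgroup H G" "L \<subseteq> H"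
      by simp_all
    have HG: "H \<subseteq> carrier G"
      using H(1) by (rule subgroup.subset)
    have "H = (\<Union>h\<in>H. L #> h)"
    proof
      show "H \<subseteq> (\<Union>h\<in>H. L #> h)"
        using HG rcos_self[OF _ sub] by blast
      show "(\<Union>h\<in>H. L #> h) \<subseteq> H"
        using H by (auto simp: r_coset_def intro: subgroup.m_closed)
    qed
    moreover have "(\<lambda>h. L #> h) ` H \<in> Pow (rcosets L)"
      using HG by (auto simp: RCOSETS_def)
    ultimately show "H \<in> Union ` Pow (rcosets L)"
      by (rule image_eqI)
  qed
  moreover have "finite (Union ` Pow (rcosets L))"
    using L by (simp add: finite_index_subgroup_def)
  ultimately show ?thesis
    by (rule finite_subset)
qed

end


section \<open>Equivalence of group chains\<close>

lemma group_chain_strict: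
  assumes "group_chain G K" "m < n"
  shows "K n \<subset> K m"
  using assms(2)
proof (induction n)
  case (Suc n)
  have "K (Suc n) \<subset> K n"
    using assms(1) by (simp add: group_chain_def)
  then show ?case
    using Suc by (cases "m = n") auto
qed simp

lemma group_chain_antimono:
  assumes "group_chain G K" "m \<le> n"
  shows "K n \<subseteq> K m"
  using group_chain_strict[OF assms(1), of m n] assms(2) by (cases "m = n") auto

lemma group_chain_subgroup:
  "group_chain G K \<Longrightarrow> subgroup (K n) G"
  by (simp add: group_chain_def finite_index_subgroup_def)

text \<open>Mutual cofinality is enough: as both chains descend properly, each inclusion can be made
  proper with an index beyond any bound, and members of \<open>K\<close> and \<open>H\<close> are
  then chosen alternately.\<close>

lemma equivalent_chainsI:
  assumes K: "group_chain G K" and H: "group_chain G H"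
    and HK: "\<And>a. \<exists>b. H b \<subseteq> K a" and KH: "\<And>a. \<exists>b. K b \<subseteq> H a"
  shows "equivalent_chains G K H"
proof -
  have HK': "\<exists>b>c. H b \<subset> K a" for a c
  proof -
    obtain b where "H b \<subseteq> K a"
      using HK by blast
    moreover have "H (Suc (max b c)) \<subset> H b"
      by (intro group_chain_strict[OF H]) auto
    ultimately have "H (Suc (max b c)) \<subset> K a"
      by blast
    then show ?thesis
      by (intro exI[of _ "Suc (max b c)"]) auto
  qed
  have KH': "\<exists>b>c. K b \<subset> H a" for a c
  proof -
    obtain b where "K b \<subseteq> H a"
      using KH by blast
    moreover have "K (Suc (max b c)) \<subset> K b"
      by (intro group_chain_strict[OF K]) auto
    ultimately have "K (Suc (max b c)) \<subset> H a"
      by blast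
    then show ?thesis
      by (intro exI[of _ "Suc (max b c)"]) auto
  qed
  \<comment> \<open>\<open>f n\<close> holds the indices of the \<open>n\<close>-th members of
    \<open>K\<close> and \<open>H\<close> in the interleaving. The first index for \<open>K\<close>
    is set to \<open>0\<close>, as the interleaved chain must begin with the whole group.\<close>
  have "\<exists>f. \<forall>n. (H (snd (f n)) \<subset> K (fst (f n)) \<and> (n = 0 \<longrightarrow> fst (f n) = 0)) \<and>
      (fst (f n) < fst (f (Suc n)) \<and> snd (f n) < snd (f (Suc n)) \<and> K (fst (f (Suc n))) \<subset> H (snd (f n)))"
    (is "\<exists>f. \<forall>n. ?P f n")
  proof (rule dependent_nat_choice)
    show "\<exists>x. H (snd x) \<subset> K (fst x) \<and> (0 = 0 \<longrightarrow> fst x = 0)"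
      using HK'[of 0 0] by auto
    fix x :: "nat \<times> nat" and n :: nat
    obtain a where a: "fst x < a" "K a \<subset> H (snd x)"
      using KH' by blast
    moreover obtain b where "snd x < b" "H b \<subset> K a"
      using HK' by blast
    ultimately show "\<exists>y. (H (snd y) \<subset> K (fst y) \<and> (Suc n = 0 \<longrightarrow> fst y = 0)) \<and>
        (fst x < fst y \<and> snd x < snd y \<and> K (fst y) \<subset> H (snd x))"
      by (intro exI[of _ "(a, b)"]) auto
  qed
  then obtain f where P: "\<forall>n. ?P f n"
    by (elim exE)
  then have f: "\<And>n. H (snd (f n)) \<subset> K (fst (f n))" "fst (f 0) = 0"
      "\<And>n. fst (f n) < fst (f (Suc n))" "\<And>n. snd (f n) < snd (f (Suc n))"
      "\<And>n. K (fst (f (Suc n))) \<subset> H (snd (f n))"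
    by simp_all
  show ?thesis
    unfolding equivalent_chains_def
  proof (intro exI conjI)
    show "strict_mono (\<lambda>n. fst (f n))" "strict_mono (\<lambda>n. snd (f n))"
      using f by (simp_all add: strict_mono_Suc_iff)
    let ?I = "\<lambda>n. if even n then K (fst (f (n div 2))) else H (snd (f (n div 2)))"
    have "?I (Suc n) \<subset> ?I n" for n
    proof (cases "even n")
      case True
      then have "Suc n div 2 = n div 2"
        by simp
      with True show ?thesis
        using f(1) by simp
    next
      case False
      then have "Suc n div 2 = Suc (n div 2)"
        by simp
      with False show ?thesis
        using f(5) by simp
    qed
    then show "group_chain G ?I"
      using K H f(2) by (simp add: group_chain_def)
  qed
qed

lemma equivalent_chainsD:
  assumes "equivalent_chains G K H"
  obtains i j :: "nat \<Rightarrow> nat" where "strict_mono i" "strict_mono j"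
    "\<And>n. H (j n) \<subseteq> K (i n)" "\<And>n. K (i (Suc n)) \<subseteq> H (j n)"
proof -
  obtain i j :: "nat \<Rightarrow> nat" where ij: "strict_mono i" "strict_mono j"
      and ch: "group_chain G (\<lambda>n. if even n then K (i (n div 2)) else H (j (n div 2)))"
    using assms unfolding equivalent_chains_def by blast
  show thesis
  proof
    show "H (j n) \<subseteq> K (i n)" "K (i (Suc n)) \<subseteq> H (j n)" for n
      using group_chain_strict[OF ch, of "2 * n" "Suc (2 * n)"]
        group_chain_strict[OF ch, of "Suc (2 * n)" "2 * Suc n"] by auto
  qed (use ij in auto)
qed

text \<open>Because the inclusion is uniform in \<open>g\<close>, a chain of conjugates of members
  of \<open>L\<close> is cofinal with \<open>L\<close> in both directions, whichever conjugating
  elements occur.\<close>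

lemma (in group) weakly_normalI:
  assumes L: "group_chain G L"
    and conj: "\<And>n. \<exists>m. \<forall>g\<in>carrier G. L m \<subseteq> conjugate_subset G g (L n)"
  shows "weakly_normal G L"
proof -
  have L0: "L 0 = carrier G"
    using L by (simp add: group_chain_def)
  have LG: "L n \<subseteq> carrier G" for n
    using group_chain_subgroup[OF L] by (rule subgroup.subset)
  have "equivalent_chains G L H"
    if H: "group_chain G H" and conj_eq: "conjugate_equivalent_chains G L H" for H
  proof -
    obtain g where g: "\<And>i. g i \<in> carrier G"
        and eq: "equivalent_chains G (\<lambda>i. conjugate_subset G (g i) (L i)) H"
      using conj_eq unfolding conjugate_equivalent_chains_def by (elim exE conjE) blast
    obtain i j :: "nat \<Rightarrow> nat" where ij: "strict_mono i" "strict_mono j"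
      and HL: "\<And>n. H (j n) \<subseteq> conjugate_subset G (g (i n)) (L (i n))"
      and LH: "\<And>n. conjugate_subset G (g (i (Suc n))) (L (i (Suc n))) \<subseteq> H (j n)"
      using equivalent_chainsD[OF eq] by blast
    show ?thesis
    proof (rule equivalent_chainsI[OF L H])
      fix a
      obtain m where m: "\<And>h. h \<in> carrier G \<Longrightarrow> L m \<subseteq> conjugate_subset G h (L a)"
        using conj by blast
      \<comment> \<open>\<open>L m\<close> lies in the conjugate of \<open>L a\<close> by the
        inverse of \<open>g (i m)\<close>. Conjugating back puts the conjugate of
        \<open>L m\<close>, and with it that of \<open>L (i m)\<close>, inside
        \<open>L a\<close>.\<close>
      have "conjugate_subset G (g (i m)) (L (i m)) \<subseteq> L a"
      proof
        fix x assume "x \<in> conjugate_subset G (g (i m)) (L (i m))"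
        then have x: "x \<in> carrier G" "inv (g (i m)) \<otimes> x \<otimes> g (i m) \<in> L (i m)"
          using LG g by (auto simp: mem_conjugate_subset_iff)
        have "L (i m) \<subseteq> L m"
          using group_chain_antimono[OF L] strict_mono_imp_increasing[OF ij(1)] by blast
        with x have "inv (g (i m)) \<otimes> x \<otimes> g (i m) \<in> conjugate_subset G (inv (g (i m))) (L a)"
          using m[of "inv (g (i m))"] g by auto
        then have "g (i m) \<otimes> (inv (g (i m)) \<otimes> x \<otimes> g (i m)) \<otimes> inv (g (i m)) \<in> L a"
          using LG g by (simp add: mem_conjugate_subset_iff)
        then show "x \<in> L a"
          using x(1) g by (simp add: m_assoc inv_mult_cancel)
      qed
      then show "\<exists>b. H b \<subseteq> L a"
        using HL by blast
      \<comment> \<open>For the other direction, the conjugate of \<open>L (i (Suc a))\<close> that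
        lies below \<open>H (j a)\<close> already contains some \<open>L m'\<close>.\<close>
      obtain m' where "\<And>h. h \<in> carrier G \<Longrightarrow> L m' \<subseteq> conjugate_subset G h (L (i (Suc a)))"
        using conj by blast
      then have "L m' \<subseteq> H (j a)"
        using g LH by blast
      moreover have "H (j a) \<subseteq> H a"
        using group_chain_antimono[OF H] strict_mono_imp_increasing[OF ij(2)] by blast
      ultimately show "\<exists>b. L b \<subseteq> H a"
        by blast
    qed
  qed
  then have "\<forall>H. group_chain G H \<and> conjugate_equivalent_chains G L H \<longrightarrow> equivalent_chains G L H"
    by (intro allI impI) (elim conjE)
  \<comment> \<open>The truncation index is \<open>0\<close>: the truncated chain is
    \<open>L\<close> and its group is \<open>G\<close> itself.\<close>
  then show ?thesis
    unfolding weakly_normal_def using L by (intro conjI exI[of _ 0]) (simp_all add: L0)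
qed


section \<open>Discarding repeated terms\<close>

text \<open>First occurrences are infinite in number, since after any \<open>n\<close> the next
  index at which the sequence drops is one. The bound \<open>n \<le> e n\<close> keeps the retained
  terms cofinal.\<close>

lemma discard_repeats_enumeration:
  fixes A :: "nat \<Rightarrow> 'a set"
  assumes anti: "\<And>n. A (Suc n) \<subseteq> A n" and desc: "\<And>n. \<exists>m>n. A m \<noteq> A n"
  obtains e :: "nat \<Rightarrow> nat" where "e 0 = 0" "\<And>n. n \<le> e n" "\<And>n. A (e (Suc n)) \<subset> A (e n)"
    "\<And>n. discard_repeats A n = A (e n)"
proof -
  define S where "S = {i. \<forall>j<i. A j \<noteq> A i}"
  have A: "A n \<subseteq> A m" if "m \<le> n" for m n
    using lift_Suc_antimono_le[of A, OF anti that] .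
  have "\<exists>m>n. m \<in> S" for n
  proof -
    define m where "m = (LEAST m. m > n \<and> A m \<noteq> A n)"
    have m: "m > n" "A m \<noteq> A n"
      using LeastI_ex[OF desc[of n]] unfolding m_def by auto
    \<comment> \<open>Strictly between \<open>n\<close> and \<open>m\<close> the terms equal
      \<open>A n\<close>. Up to \<open>n\<close> they contain \<open>A n\<close>, so equality with
      \<open>A m\<close> would squeeze \<open>A n\<close> onto \<open>A m\<close>.\<close>
    have "A j \<noteq> A m" if "j < m" for j
    proof (cases "j > n")
      case True
      then have "A j = A n"
        using not_less_Least[of j "\<lambda>m. m > n \<and> A m \<noteq> A n"] that unfolding m_def by blast
      then show ?thesis
        using m by simp
    next
      case False
      then show ?thesis
        using A[of j n] A[of n m] m by auto
    qed
    then show ?thesis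
      using m(1) by (auto simp: S_def)
  qed
  then have inf: "infinite S"
    by (simp add: infinite_nat_iff_unbounded)
  show thesis
  proof
    show "enumerate S 0 = 0"
      by (auto simp: enumerate_0 S_def intro: Least_equality)
    show "n \<le> enumerate S n" for n
      using inf by (rule le_enumerate)
    show "A (enumerate S (Suc n)) \<subset> A (enumerate S n)" for n
    proof -
      have lt: "enumerate S n < enumerate S (Suc n)"
        using inf by (rule enumerate_step)
      moreover have "enumerate S (Suc n) \<in> S"
        using inf by (rule enumerate_in_set)
      ultimately have "A (enumerate S n) \<noteq> A (enumerate S (Suc n))"
        unfolding S_def by blast
      then show ?thesis
        using A[of "enumerate S n" "enumerate S (Suc n)"] lt by auto
    qed
    show "discard_repeats A n = A (enumerate S n)" for n
      by (simp add: discard_repeats_def S_def)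
  qed
qed


section \<open>A finite discriminant group\<close>

text \<open>Equivalently, the open normal subgroup of the closure of the action determined by
  \<open>normal_core G (K i)\<close> meets the discriminant group trivially.\<close>

definition core_trapped :: "('g, 'b) monoid_scheme \<Rightarrow> (nat \<Rightarrow> 'g set) \<Rightarrow> bool" where
  "core_trapped G K \<longleftrightarrow> (\<exists>i. \<forall>j. \<exists>m. K m \<inter> normal_core G (K i) \<subseteq> normal_core G (K j))"

text \<open>An element trapped in the normal core of a member stays in that member under
  conjugation, and stays in \<open>normal_core G (K i)\<close> under conjugation by elements of it.
  This is the uniform inclusion that \<open>weakly_normalI\<close> asks for.\<close>

lemma (in group) weakly_normal_discard_repeats:
  assumes K: "group_chain G K"
    and trap: "\<And>j. \<exists>m. K m \<inter> normal_core G (K i) \<subseteq> normal_core G (K j)"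
  shows "weakly_normal (G\<lparr>carrier := normal_core G (K i)\<rparr>)
           (discard_repeats (\<lambda>n. K n \<inter> normal_core G (K i)))"
proof -
  define C where "C = normal_core G (K i)"
  define A where "A = (\<lambda>n. K n \<inter> C)"
  have K_fin: "finite_index_subgroup (K n) G" for n
    using K by (simp add: group_chain_def)
  have KG: "K n \<subseteq> carrier G" for n
    using group_chain_subgroup[OF K] by (rule subgroup.subset)
  have C_fin: "finite_index_subgroup C G"
    unfolding C_def using K_fin by (rule finite_index_subgroup_normal_core)
  then have C: "subgroup C G"
    by (simp add: finite_index_subgroup_def)
  have CG: "C \<subseteq> carrier G"
    using C by (rule subgroup.subset)
  have A_fin: "finite_index_subgroup (A n) G" for n
    unfolding A_def using K_fin C_fin by (rule finite_index_subgroup_Int)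
  have A_anti: "A n \<subseteq> A m" if "m \<le> n" for m n
    using group_chain_antimono[OF K that] by (auto simp: A_def)
  \<comment> \<open>The intersected chain cannot stabilize: a final term \<open>A n\<close> would
    lie in all the distinct \<open>K m\<close>, but it has finite index and hence only finitely many
    overgroups.\<close>
  have "\<exists>m>n. A m \<noteq> A n" for n
  proof (rule ccontr)
    assume "\<not> (\<exists>m>n. A m \<noteq> A n)"
    then have eq: "A m = A n" if "m > n" for m
      using that by blast
    have "A n \<subseteq> K m" for m
    proof -
      have "A n \<subseteq> A m"
        using A_anti[of m n] eq[of m] by (cases "m > n") auto
      then show ?thesis
        by (auto simp: A_def)
    qed
    then have "range K \<subseteq> {H. subgroup H G \<and> A n \<subseteq> H}"
      using group_chain_subgroup[OF K] by auto
    then have "finite (range K)"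
      using finite_overgroups[OF A_fin] by (rule finite_subset)
    moreover have "inj K"
      by (rule linorder_injI) (metis group_chain_strict[OF K] less_irrefl)
    ultimately show False
      using finite_imageD by blast
  qed
  then obtain e where e: "e 0 = 0" "\<And>n. n \<le> e n" "\<And>n. A (e (Suc n)) \<subset> A (e n)"
      and L: "\<And>n. discard_repeats A n = A (e n)"
    using discard_repeats_enumeration[of A] A_anti by (metis le_SucI order_refl)
  have "group (G\<lparr>carrier := C\<rparr>)"
    using C by (rule subgroup_imp_group)
  moreover have "group_chain (G\<lparr>carrier := C\<rparr>) (discard_repeats A)"
    unfolding group_chain_def
  proof (intro conjI allI)
    have "K 0 = carrier G"
      using K by (simp add: group_chain_def)
    then show "discard_repeats A 0 = carrier (G\<lparr>carrier := C\<rparr>)"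
      using L e CG by (auto simp: A_def)
    show "finite_index_subgroup (discard_repeats A n) (G\<lparr>carrier := C\<rparr>)" for n
      unfolding L using A_fin C by (rule finite_index_subgroup_restrict) (simp add: A_def)
    show "discard_repeats A (Suc n) \<subset> discard_repeats A n" for n
      using e by (simp add: L)
  qed
  moreover have "\<exists>m. \<forall>g\<in>carrier (G\<lparr>carrier := C\<rparr>).
      discard_repeats A m \<subseteq> conjugate_subset (G\<lparr>carrier := C\<rparr>) g (discard_repeats A n)" for n
  proof -
    \<comment> \<open>The trap is applied to the member of \<open>K\<close> behind the
      \<open>n\<close>-th retained term; \<open>m \<le> e m\<close> then gives
      \<open>A (e m) \<subseteq> K m\<close>.\<close>
    obtain m where m: "K m \<inter> C \<subseteq> normal_core G (K (e n))"
      using trap unfolding C_def by blast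
    have "A (e m) \<subseteq> conjugate_subset (G\<lparr>carrier := C\<rparr>) g (A (e n))" if g: "g \<in> C" for g
    proof
      fix x assume x: "x \<in> A (e m)"
      then have xC: "x \<in> C" and "x \<in> K m"
        using A_anti[OF e(2)[of m]] by (auto simp: A_def)
      then have "x \<in> normal_core G (K (e n))"
        using m by blast
      then have "inv g \<otimes> x \<otimes> g \<in> K (e n)"
        using g CG KG by (auto simp: mem_normal_core_iff)
      moreover have "inv g \<otimes> x \<otimes> g \<in> C"
        using C g xC by (simp add: subgroup.m_closed subgroup.m_inv_closed)
      ultimately have "inv g \<otimes> x \<otimes> g \<in> A (e n)"
        by (simp add: A_def)
      then show "x \<in> conjugate_subset (G\<lparr>carrier := C\<rparr>) g (A (e n))"
        using xC g C group.mem_conjugate_subset_iff[OF subgroup_imp_group[OF C], of g "A (e n)" x]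
        by (simp add: A_def)
    qed
    then show ?thesis
      unfolding L by auto
  qed
  ultimately have "weakly_normal (G\<lparr>carrier := C\<rparr>) (discard_repeats A)"
    by (rule group.weakly_normalI)
  then show ?thesis
    by (simp add: C_def A_def)
qed

section \<open>Coherent sequences of cosets and the compactness argument\<close>

lemma mem_inverse_limit_iff:
  "s \<in> carrier (inverse_limit A \<beta>) \<longleftrightarrow>
     (\<forall>n. s n \<in> carrier (A n)) \<and> (\<forall>n. \<beta> n (s (Suc n)) = s n)"
  by (simp add: inverse_limit_def PiE_UNIV_domain Pi_iff)

lemma carrier_subgroup_FactGroup:
  "carrier ((G\<lparr>carrier := M\<rparr>) Mod N) = r_coset G N ` M"
  by (simp add: carrier_FactGroup r_coset_def)

lemma mem_discriminant_group_iff: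
  "s \<in> carrier (discriminant_group G K) \<longleftrightarrow>
     (\<forall>n. s n \<in> r_coset G (normal_core G (K n)) ` K n) \<and>
     (\<forall>n. normal_core G (K n) <#>\<^bsub>G\<^esub> s (Suc n) = s n)"
  unfolding discriminant_group_def mem_inverse_limit_iff carrier_subgroup_FactGroup ..

text \<open>Finitely many nontrivial elements are all nontrivial at one common level
  \<open>i\<close>. If no \<open>K m \<inter> C i\<close> were contained in \<open>C j\<close>,
  compactness would produce an element that is trivial at level \<open>i\<close> but not at level
  \<open>j\<close>.\<close>

lemma (in group) core_trapped_if_finite_discriminant:
  assumes K: "group_chain G K" and fin: "finite (carrier (discriminant_group G K))"
  shows "core_trapped G K"
proof -
  define C where "C n = normal_core G (K n)" for n
  define D where "D = carrier (discriminant_group G K)"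
  have C_fin: "finite_index_subgroup (C n) G" for n
    unfolding C_def using K by (intro finite_index_subgroup_normal_core) (simp add: group_chain_def)
  then have C: "subgroup (C n) G" for n
    by (simp add: finite_index_subgroup_def)
  have CG: "C n \<subseteq> carrier G" for n
    using C by (rule subgroup.subset)
  have KG: "K n \<subseteq> carrier G" for n
    using group_chain_subgroup[OF K] by (rule subgroup.subset)
  have C_anti: "C n \<subseteq> C m" if "m \<le> n" for m n
    unfolding C_def using group_chain_antimono[OF K that] by (rule normal_core_mono)
  have CK: "C n \<subseteq> K n" for n
    unfolding C_def using KG by (rule normal_core_subset)
  have CC: "C m <#> C n = C m" if "m \<le> n" for m n
  proof
    show "C m <#> C n \<subseteq> C m"
      using C C_anti[OF that] by (auto simp: set_mult_def intro: subgroup.m_closed)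
    show "C m \<subseteq> C m <#> C n"
    proof
      fix x assume "x \<in> C m"
      moreover from this have "x = x \<otimes> \<one>"
        using CG[of m] by (simp add: subsetD)
      moreover have "\<one> \<in> C n"
        using C by (rule subgroup.one_closed)
      ultimately show "x \<in> C m <#> C n"
        unfolding set_mult_def by blast
    qed
  qed
  have CCa: "C m <#> (C n #> a) = C m #> a" if "m \<le> n" "a \<in> carrier G" for m n a
    using CC[OF that(1)] setmult_rcos_assoc[OF CG CG that(2)] by simp
  have D_iff: "s \<in> D \<longleftrightarrow> (\<forall>n. s n \<in> (\<lambda>a. C n #> a) ` K n) \<and> (\<forall>n. C n <#> s (Suc n) = s n)" for s
    unfolding D_def C_def by (rule mem_discriminant_group_iff)
  \<comment> \<open>The sequence \<open>C\<close> is the identity of the discriminant group,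
    \<open>C n\<close> being the trivial coset at level \<open>n\<close>. \<open>N\<close> picks for
    every other element a level where it is nontrivial.\<close>
  have "\<forall>s\<in>D. \<exists>n. s = C \<or> s n \<noteq> C n"
    by auto
  then obtain N where N: "\<And>s. s \<in> D \<Longrightarrow> s = C \<or> s (N s) \<noteq> C (N s)"
    by metis
  define i where "i = Max (insert 0 (N ` D))"
  have N_le: "N s \<le> i" if "s \<in> D" for s
    unfolding i_def using fin that by (intro Max_ge) (auto simp: D_def)
  \<comment> \<open>The bonding maps preserve trivial cosets, so an element trivial at level
    \<open>i\<close> is trivial at all lower levels, in particular at level
    \<open>N s\<close>.\<close>
  have down: "s m = C m" if s: "s \<in> D" "s n = C n" and "m \<le> n" for s m n
    using \<open>m \<le> n\<close>
  proof (induction rule: inc_induct)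
    case base
    then show ?case using s by simp
  next
    case (step m)
    then show ?case
      using s(1) CC[of m "Suc m"] by (metis D_iff le_SucI order_refl)
  qed
  have sep: "s = C" if "s \<in> D" "s i = C i" for s
    using N[OF that(1)] down[OF that N_le[OF that(1)]] by blast
  have "\<exists>m. K m \<inter> C i \<subseteq> C j" for j
  proof (rule ccontr)
    assume "\<not> ?thesis"
    then have "\<forall>m. \<exists>x. x \<in> K m \<and> x \<in> C i \<and> x \<notin> C j"
      by blast
    then obtain x where x: "\<And>m. x m \<in> K m" "\<And>m. x m \<in> C i" "\<And>m. x m \<notin> C j"
      by metis
    have xG: "x m \<in> carrier G" for m
      using x(1) KG by blast
    \<comment> \<open>Koenig's lemma, following cosets that contain infinitely many of the \<open>x m\<close>\<close>
    have refine: "\<exists>a\<in>M. infinite {m \<in> M. C n #> x m = C n #> x a}" if "infinite M" for M n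
    proof -
      have "finite ((\<lambda>m. C n #> x m) ` M)"
      proof (rule finite_subset)
        show "(\<lambda>m. C n #> x m) ` M \<subseteq> rcosets (C n)"
          using xG by (auto simp: RCOSETS_def)
      qed (use C_fin in \<open>simp add: finite_index_subgroup_def\<close>)
      then show ?thesis
        using pigeonhole_infinite[OF that] by blast
    qed
    \<comment> \<open>\<open>x (a n)\<close> represents the coset chosen at level \<open>n\<close>.
      Infinitely many terms lie in it, and one of the finitely many cosets of
      \<open>C (Suc n)\<close> captures infinitely many of those.\<close>
    have "\<exists>a. \<forall>n. infinite {m. C n #> x m = C n #> x (a n)} \<and> C n #> x (a (Suc n)) = C n #> x (a n)"
    proof (rule dependent_nat_choice)
      show "\<exists>a. infinite {m. C 0 #> x m = C 0 #> x a}"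
        using refine[of UNIV 0] by auto
      fix a n assume "infinite {m. C n #> x m = C n #> x a}"
      then obtain b where b: "C n #> x b = C n #> x a"
          "infinite {m \<in> {m. C n #> x m = C n #> x a}. C (Suc n) #> x m = C (Suc n) #> x b}"
        using refine[of _ "Suc n"] by blast
      then have "infinite {m. C (Suc n) #> x m = C (Suc n) #> x b}"
        by (auto elim: infinite_super[rotated])
      then show "\<exists>b. infinite {m. C (Suc n) #> x m = C (Suc n) #> x b} \<and> C n #> x b = C n #> x a"
        using b(1) by blast
    qed
    then obtain a where a_inf: "\<And>n. infinite {m. C n #> x m = C n #> x (a n)}"
        and a_Suc: "\<And>n. C n #> x (a (Suc n)) = C n #> x (a n)"
      by blast
    define s where "s n = C n #> x (a n)" for n
    have "s \<in> D"
      unfolding D_iff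
    proof (intro conjI allI)
      fix n
      \<comment> \<open>An infinite class contains some \<open>x m\<close> with
        \<open>m \<ge> n\<close>, so the chosen coset has a representative in
        \<open>K m \<subseteq> K n\<close>.\<close>
      obtain m where "m \<ge> n" "C n #> x m = C n #> x (a n)"
        using a_inf[of n] unfolding infinite_nat_iff_unbounded_le by blast
      then show "s n \<in> (\<lambda>a. C n #> a) ` K n"
        using group_chain_antimono[OF K, of n m] x(1)[of m] unfolding s_def by blast
      show "C n <#> s (Suc n) = s n"
        unfolding s_def using CCa[OF _ xG] a_Suc by simp
    qed
    \<comment> \<open>All \<open>x m\<close> lie in \<open>C i\<close>, so \<open>s\<close> is
      trivial at level \<open>i\<close> and hence everywhere, whereas \<open>x (a j)\<close> is
      outside \<open>C j\<close>.\<close>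
    moreover have "s i = C i"
      unfolding s_def using xG C x(2) by (rule coset_join2)
    ultimately have "s = C"
      by (rule sep)
    then have "C j #> x (a j) = C j"
      by (simp add: s_def fun_eq_iff)
    then have "x (a j) \<in> C j"
      using xG C by (rule coset_join1)
    then show False
      using x(3) by blast
  qed
  then show ?thesis
    unfolding core_trapped_def C_def by blast
qed


section \<open>Change of basepoint\<close>

text \<open>Normal cores do not change under conjugation, so inclusions up to conjugacy give
  inclusions of cores. An element of \<open>K m\<close> is conjugated into \<open>H m'\<close>,
  trapped there in a normal core, and conjugated back inside it.\<close>

lemma (in group) core_trapped_transfer:
  assumes K: "group_chain G K" and H: "group_chain G H"
    and KH: "\<And>j. \<exists>m. \<exists>h\<in>carrier G. K m \<subseteq> conjugate_subset G h (H j)"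
    and HK: "\<And>j. \<exists>m. \<exists>h\<in>carrier G. H m \<subseteq> conjugate_subset G h (K j)"
    and trap: "core_trapped G H"
  shows "core_trapped G K"
proof -
  have KG: "K n \<subseteq> carrier G" and HG: "H n \<subseteq> carrier G" for n
    using group_chain_subgroup[OF K] group_chain_subgroup[OF H] subgroup.subset by blast+
  have core: "normal_core G M \<subseteq> normal_core G N"
    if h: "h \<in> carrier G" and MN: "M \<subseteq> conjugate_subset G h N"
      and MG: "M \<subseteq> carrier G" and NG: "N \<subseteq> carrier G" for h M N
  proof
    fix x assume "x \<in> normal_core G M"
    then have xG: "x \<in> carrier G" and x: "\<And>g. g \<in> carrier G \<Longrightarrow> inv g \<otimes> x \<otimes> g \<in> M"
      using MG by (auto simp: mem_normal_core_iff)
    \<comment> \<open>The membership in \<open>M\<close> is used at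
      \<open>g \<otimes> inv h\<close>, so that the conjugation by \<open>h\<close> coming from
      \<open>MN\<close> cancels.\<close>
    have "inv g \<otimes> x \<otimes> g \<in> N" if g: "g \<in> carrier G" for g
    proof -
      have "inv (g \<otimes> inv h) \<otimes> x \<otimes> (g \<otimes> inv h) \<in> conjugate_subset G h N"
        by (rule subsetD[OF MN x]) (use g h in simp)
      then have "inv h \<otimes> (inv (g \<otimes> inv h) \<otimes> x \<otimes> (g \<otimes> inv h)) \<otimes> h \<in> N"
        using h NG by (simp add: mem_conjugate_subset_iff)
      then show ?thesis
        using g h xG by (simp add: inv_mult_group m_assoc inv_mult_cancel)
    qed
    then show "x \<in> normal_core G N"
      using xG NG by (simp add: mem_normal_core_iff)
  qed
  obtain i' where i': "\<And>j. \<exists>m. H m \<inter> normal_core G (H i') \<subseteq> normal_core G (H j)"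
    using trap unfolding core_trapped_def by blast
  obtain i where i: "normal_core G (K i) \<subseteq> normal_core G (H i')"
    using KH[of i'] core[OF _ _ KG HG] by blast
  have "\<exists>m. K m \<inter> normal_core G (K i) \<subseteq> normal_core G (K j)" for j
  proof -
    obtain j' where j': "normal_core G (H j') \<subseteq> normal_core G (K j)"
      using HK[of j] core[OF _ _ HG KG] by blast
    obtain m' where m': "H m' \<inter> normal_core G (H i') \<subseteq> normal_core G (H j')"
      using i' by blast
    obtain m h where h: "h \<in> carrier G" and m: "K m \<subseteq> conjugate_subset G h (H m')"
      using KH by blast
    have "x \<in> normal_core G (H j')" if x: "x \<in> K m" "x \<in> normal_core G (K i)" for x
    proof -
      have xG: "x \<in> carrier G"
        using x(1) KG by blast
      have "inv h \<otimes> x \<otimes> h \<in> H m'"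
        using x(1) m h HG by (auto simp: mem_conjugate_subset_iff)
      moreover have "inv h \<otimes> x \<otimes> h \<in> normal_core G (H i')"
        using x(2) i h HG by (intro conj_mem_normal_core) auto
      ultimately have "inv h \<otimes> x \<otimes> h \<in> normal_core G (H j')"
        using m' by blast
      then have "inv (inv h) \<otimes> (inv h \<otimes> x \<otimes> h) \<otimes> inv h \<in> normal_core G (H j')"
        by (rule conj_mem_normal_core[OF HG _ inv_closed[OF h]])
      then show ?thesis
        using h xG by (simp add: m_assoc inv_mult_cancel)
    qed
    then show ?thesis
      using j' by blast
  qed
  then show ?thesis
    unfolding core_trapped_def by blast
qed

section \<open>Comparison of two families of clopen sets\<close>

lemma compact_if_Cantor_set:
  assumes "Cantor_set X"
  shows "compact X"
proof -
  have "compact_space (euclidean :: bool topology)"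
    by (simp add: compact_space_def finite_imp_compact)
  then have "compact_space (product_topology (\<lambda>i::nat. euclidean :: bool topology) UNIV)"
    by (simp add: compact_space_product_topology)
  then have "compact (UNIV :: (nat \<Rightarrow> bool) set)"
    by (simp add: euclidean_product_topology compact_space_def)
  then show ?thesis
    using assms homeomorphic_compactness unfolding Cantor_set_def by blast
qed

text \<open>A set \<open>V m\<close> of small diameter lies in the translate of \<open>W j\<close>
  that contains \<open>x\<close>. An element stabilizing \<open>V m\<close> moves this translate to
  one that still meets it, hence preserves it by the partition property; a conjugate of the element
  then stabilizes \<open>W j\<close>.\<close>

lemma associated_chain_refines:
  fixes G :: "('g, 'b) monoid_scheme" (structure) and X :: "'x::metric_space set"
  assumes act: "action_by_homeomorphisms G X \<Phi>" and cpt: "compact X" and "x \<in> X"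
    and K: "associated_group_chain G X \<Phi> x K" and H: "associated_group_chain G X \<Phi> y H"
  shows "\<exists>m. \<exists>h\<in>carrier G. K m \<subseteq> conjugate_subset G h (H j)"
proof -
  interpret group_action G X \<Phi>
    using act by (simp add: action_by_homeomorphisms_def)
  interpret group G using group_hom group_hom.axioms(1) by blast
  obtain V where V: "(\<Inter>i. V i) = {x}" "\<And>i. openin (top_of_set X) (V i)"
      "\<And>i g. i \<ge> 1 \<Longrightarrow> g \<in> carrier G \<Longrightarrow> diameter (\<Phi> g ` V i) < 1 / 2 ^ i"
      "\<And>i. K i = {g \<in> carrier G. \<Phi> g ` V i = V i}"
    using K unfolding associated_group_chain_def
    by (elim conjE exE) (rule that, assumption, simp_all)
  obtain W where "\<And>i. openin (top_of_set X) (W i) \<and> closedin (top_of_set X) (W i)"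
      "\<And>i. finite {\<Phi> g ` W i | g. g \<in> carrier G} \<and> partition_on X {\<Phi> g ` W i | g. g \<in> carrier G}"
      "\<And>i. H i = {g \<in> carrier G. \<Phi> g ` W i = W i}"
    using H unfolding associated_group_chain_def
    by (elim conjE exE) (rule that, (erule allE, assumption)+)
  then have W: "\<And>i. openin (top_of_set X) (W i)"
      "\<And>i. partition_on X {\<Phi> g ` W i | g. g \<in> carrier G}"
      "\<And>i. H i = {g \<in> carrier G. \<Phi> g ` W i = W i}"
    by simp_all
  have VX: "V i \<subseteq> X" and WX: "W i \<subseteq> X" for i
    using V(2) W(1) openin_imp_subset by blast+
  have img_mult: "\<Phi> (a \<otimes> b) ` S = \<Phi> a ` \<Phi> b ` S"
    if "a \<in> carrier G" "b \<in> carrier G" "S \<subseteq> X" for a b S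
    using that composition_rule by (force simp: image_image)
  have img_one: "\<Phi> \<one> ` S = S" if "S \<subseteq> X" for S
    using that id_eq_one by (metis (no_types, lifting) image_cong image_ident restrict_apply' subsetD)
  obtain h where h: "h \<in> carrier G" "x \<in> \<Phi> h ` W j"
    using \<open>x \<in> X\<close> partition_onD1[OF W(2)[of j]] by blast
  have "openin (top_of_set X) (\<Phi> h ` W j)"
    using act h(1) W(1) homeomorphism_imp_open_map unfolding action_by_homeomorphisms_def by blast
  then have "\<exists>\<epsilon>>0. \<forall>z\<in>X. dist z x < \<epsilon> \<longrightarrow> z \<in> \<Phi> h ` W j"
    using h(2) unfolding openin_euclidean_subtopology_iff by (elim conjE) (rule bspec)
  then obtain \<epsilon> where \<epsilon>: "\<epsilon> > 0" "\<forall>z\<in>X. dist z x < \<epsilon> \<longrightarrow> z \<in> \<Phi> h ` W j"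
    by (elim exE conjE)
  obtain k where k: "(1 / 2) ^ k < \<epsilon>"
    using real_arch_pow_inv[OF \<epsilon>(1), of "1 / 2"] by auto
  \<comment> \<open>One more than \<open>k\<close>, since the diameter bound holds only from index
    \<open>1\<close> on.\<close>
  define m where "m = Suc k"
  have m: "(1 / 2) ^ m < \<epsilon>" "m \<ge> 1"
    using k \<epsilon>(1) unfolding m_def by (simp_all add: field_simps)
  have V_sub: "V m \<subseteq> \<Phi> h ` W j"
  proof
    fix z assume z: "z \<in> V m"
    \<comment> \<open>Compactness of \<open>X\<close> makes \<open>V m\<close> bounded, so that its
      diameter does bound distances.\<close>
    have "dist z x \<le> diameter (V m)"
      using z V(1) bounded_subset[OF compact_imp_bounded[OF cpt] VX]
      by (intro diameter_bounded_bound) auto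
    also have "\<dots> < (1 / 2) ^ m"
      using V(3)[OF m(2) one_closed] img_one[OF VX] by (simp add: power_one_over)
    finally show "z \<in> \<Phi> h ` W j"
      using \<epsilon>(2)[rule_format, of z] subsetD[OF VX z] m(1) by linarith
  qed
  have "g \<in> conjugate_subset G h (H j)" if "g \<in> K m" for g
  proof -
    have g: "g \<in> carrier G" "\<Phi> g ` V m = V m"
      using that V(4) by auto
    have "V m \<subseteq> \<Phi> (g \<otimes> h) ` W j"
      using image_mono[OF V_sub, of "\<Phi> g"] g(2) img_mult[OF g(1) h(1) WX] by simp
    moreover have "x \<in> V m"
      using V(1) by blast
    \<comment> \<open>Both translates contain \<open>V m\<close>, which is nonempty because of
      \<open>x\<close>.\<close>
    ultimately have meet: "\<Phi> (g \<otimes> h) ` W j \<inter> \<Phi> h ` W j \<noteq> {}"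
      using V_sub by blast
    have mem: "\<Phi> (g \<otimes> h) ` W j \<in> {\<Phi> g ` W j | g. g \<in> carrier G}"
        "\<Phi> h ` W j \<in> {\<Phi> g ` W j | g. g \<in> carrier G}"
      using g(1) h(1) by blast+
    have eq: "\<Phi> (g \<otimes> h) ` W j = \<Phi> h ` W j"
      using disjointD[OF partition_onD2[OF W(2)] mem] meet by argo
    have "\<Phi> (inv h \<otimes> g \<otimes> h) ` W j = \<Phi> (inv h) ` \<Phi> (g \<otimes> h) ` W j"
      using g h WX by (simp add: m_assoc img_mult)
    also have "\<dots> = \<Phi> (inv h \<otimes> h) ` W j"
      unfolding eq by (rule img_mult[symmetric]) (use h WX in simp_all)
    also have "\<dots> = W j"
      using h img_one[OF WX] by simp
    finally have "inv h \<otimes> g \<otimes> h \<in> H j"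
      using g h by (simp add: W(3))
    then show ?thesis
      using g h W(3) by (subst mem_conjugate_subset_iff) auto
  qed
  then show ?thesis
    using h(1) by blast
qed

theorem theorem1p13:
  fixes G :: "('g, 'b) monoid_scheme"
    and X :: "'x::metric_space set"
    and \<Phi> :: "'g \<Rightarrow> 'x \<Rightarrow> 'x"
  assumes "finitely_generated_group G"
    and "infinite (carrier G)"
    and "Cantor_set X"
    and "action_by_homeomorphisms G X \<Phi>"
    and "minimal_action G X \<Phi>"
    and "equicontinuous_action G X \<Phi>"
    and "\<exists>x\<in>X. \<exists>K. associated_group_chain G X \<Phi> x K \<and> finite (carrier (discriminant_group G K))"
  shows "virtually_regular G X \<Phi>"
proof -
  interpret group G
    using assms(1) by (simp add: finitely_generated_group_def)
  have cpt: "compact X"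
    using assms(3) by (rule compact_if_Cantor_set)
  obtain y H where y: "y \<in> X" and H: "associated_group_chain G X \<Phi> y H"
      and fin: "finite (carrier (discriminant_group G H))"
    using assms(7) by blast
  have H': "group_chain G H"
    using H by (simp add: associated_group_chain_def)
  have trap: "core_trapped G H"
    using H' fin by (rule core_trapped_if_finite_discriminant)
  show ?thesis
    unfolding virtually_regular_def
  proof (intro ballI allI impI)
    fix x K assume x: "x \<in> X" and K: "associated_group_chain G X \<Phi> x K"
    have K': "group_chain G K"
      using K by (simp add: associated_group_chain_def)
    \<comment> \<open>The two chains may come from different basepoints and clopen sets. Each
      refines the other up to conjugation, so the trap found for \<open>H\<close> passes to
      \<open>K\<close>.\<close>
    have "core_trapped G K"
      using K' H' associated_chain_refines[OF assms(4) cpt x K H]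
        associated_chain_refines[OF assms(4) cpt y H K] trap
      by (rule core_trapped_transfer)
    then obtain i where i: "\<And>j. \<exists>m. K m \<inter> normal_core G (K i) \<subseteq> normal_core G (K j)"
      unfolding core_trapped_def by blast
    \<comment> \<open>The core of \<open>K i\<close> serves as the subgroup
      \<open>G'\<close>.\<close>
    have "finite_index_subgroup (normal_core G (K i)) G"
      using K' by (intro finite_index_subgroup_normal_core) (simp add: group_chain_def)
    then show "\<exists>G'. finite_index_subgroup G' G \<and>
        weakly_normal (G\<lparr>carrier := G'\<rparr>) (discard_repeats (\<lambda>i. K i \<inter> G'))"
      using weakly_normal_discard_repeats[OF K' i] by blast
  qed
qed

end
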